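(* Let $L\subseteq L_\beta$ be a sublattice with $\operatorname{rank} L=n$. Then $V_{X(\mathbb K)}(I_L)$ is a subgroup of $T_X(\mathbb K)$.
   Context: $\mathbb K$ is a field with algebraic closure $\overline{\mathbb K}$. $\Sigma$ is a complete simplicial fan in $\mathbb R^n$ with rays $\rho_1,\dots,\rho_r$ generated by primitive lattice vectors $\mathbf v_1,\dots,\mathbf v_r\in\mathbb Z^n$, and $X=X_\Sigma$ is the corresponding split toric variety over $\mathbb K$; its class group $\operatorname{Cl}X$ is assumed to be free. Let $\phi:\mathbb Z^n\to\mathbb Z^r$ be the $r\times n$ matrix with rows $\mathbf v_1,\dots,\mathbf v_r$, let $d=r-n$, and let $\beta:\mathbb Z^r\to\mathbb Z^d\cong \operatorname{Cl}X$ be an integer matrix such that $0\to\mathbb Z^n\xrightarrow{\phi}\mathbb Z^r\xrightarrow{\beta}\mathbb Z^d\to0$ is exact. $L_\beta=\operatorname{im}\phi=\ker\beta\subseteq\mathbb Z^r$, a lattice of rank $n$. The Cox ring $S=\mathbb K[x_1,\dots,x_r]$ is graded by $\deg x_j=\beta_j$, the $j$-th column of $\beta$; "homogeneous" refers to this grading. For a sublattice $L\subseteq L_\beta$, the lattice ideal is $I_L=\langle \mathbf x^{\mathbf m^+}-\mathbf x^{\mathbf m^-} : \mathbf m=\mathbf m^+-\mathbf m^-\in L\rangle\subseteq S$, where $\mathbf m^{\pm}\in\mathbb N^r$ are the positive and negative parts of $\mathbf m$. $B\subseteq S$ is the monomial ideal generated by $\prod_{\rho_i\not\subseteq\sigma}x_i$,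 $\sigma\in\Sigma$. $G=\{P\in(\overline{\mathbb K}^* )^r : \mathbf x^{\mathbf m}(P)=1 \text{ for all } \mathbf m\in L_\beta\}$, where $\mathbf x^{\mathbf a}(P)=p_1^{a_1}\cdots p_r^{a_r}$. The points $X(\overline{\mathbb K})$ are identified with the $G$-orbits in $\overline{\mathbb K}^r\setminus V(B)$; $X(\mathbb K)$ is the set of orbits $[P]=G\cdot P$ with $P\in\mathbb K^r\setminus V(B)$; $T_X(\mathbb K)$ is the group (under coordinatewise multiplication) of orbits $[P]$ with $P\in(\mathbb K^* )^r$. For a homogeneous ideal $J$, $V_{X(\mathbb K)}(J)=\{[P]\in X(\mathbb K): F(P)=0\text{ for all homogeneous }F\in J\}$. *)

theory Defs
  imports
    "HOL-Analysis.Analysis"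
    "HOL-Library.Poly_Mapping"
    "HOL-Algebra.Algebraic_Closure_Type"
begin

section \<open>Fans\<close>

definition real_vec :: "int ^ 'n \<Rightarrow> real ^ 'n" where
  "real_vec u = (\<chi> j. of_int (u $ j))"

definition rational_polyhedral_cone :: "(real ^ 'n) set \<Rightarrow> bool" where
  "rational_polyhedral_cone \<sigma> \<longleftrightarrow>
     (\<exists>S :: (int ^ 'n) set. finite S \<and> \<sigma> = convex_cone hull (real_vec ` S))"

definition strongly_convex :: "(real ^ 'n) set \<Rightarrow> bool" where
  "strongly_convex \<sigma> \<longleftrightarrow> \<sigma> \<inter> uminus ` \<sigma> = {0}"

text \<open>The library's \<open>face_of\<close> admits the empty set as a face. The nonempty convex faces of a
  polyhedral cone are exactly its faces in the sense of toric geometry.\<close>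

definition cone_face :: "(real ^ 'n) set \<Rightarrow> (real ^ 'n) set \<Rightarrow> bool" where
  "cone_face \<tau> \<sigma> \<longleftrightarrow> \<tau> face_of \<sigma> \<and> \<tau> \<noteq> {}"

definition fan :: "(real ^ 'n) set set \<Rightarrow> bool" where
  "fan \<Sigma> \<longleftrightarrow>
     finite \<Sigma> \<and>
     (\<forall>\<sigma>\<in>\<Sigma>. rational_polyhedral_cone \<sigma> \<and> strongly_convex \<sigma>) \<and>
     (\<forall>\<sigma>\<in>\<Sigma>. \<forall>\<tau>. cone_face \<tau> \<sigma> \<longrightarrow> \<tau> \<in> \<Sigma>) \<and>
     (\<forall>\<sigma>\<in>\<Sigma>. \<forall>\<tau>\<in>\<Sigma>. cone_face (\<sigma> \<inter> \<tau>) \<sigma> \<and> cone_face (\<sigma> \<inter> \<tau>) \<tau>)"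

definition complete_fan :: "(real ^ 'n) set set \<Rightarrow> bool" where
  "complete_fan \<Sigma> \<longleftrightarrow> fan \<Sigma> \<and> \<Union>\<Sigma> = UNIV"

definition simplicial_fan :: "(real ^ 'n) set set \<Rightarrow> bool" where
  "simplicial_fan \<Sigma> \<longleftrightarrow>
     fan \<Sigma> \<and> (\<forall>\<sigma>\<in>\<Sigma>. \<exists>S. independent S \<and> \<sigma> = convex_cone hull S)"

definition primitive :: "int ^ 'n \<Rightarrow> bool" where
  "primitive u \<longleftrightarrow> Gcd (range (($) u)) = 1"

text \<open>The rays are indexed by the finite type \<^typ>\<open>'r\<close>. The matrix \<open>\<phi>\<close> has the ray
  generators as its rows.\<close>

definition ray :: "int ^ 'n ^ 'r \<Rightarrow> 'r \<Rightarrow> (real ^ 'n) set" where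
  "ray \<phi> i = convex_cone hull {real_vec (\<phi> $ i)}"

definition ray_generators :: "(real ^ 'n) set set \<Rightarrow> int ^ 'n ^ 'r \<Rightarrow> bool" where
  "ray_generators \<Sigma> \<phi> \<longleftrightarrow>
     (\<forall>i. primitive (\<phi> $ i)) \<and> bij_betw (ray \<phi>) UNIV {\<rho> \<in> \<Sigma>. dim \<rho> = 1}"

section \<open>Lattices\<close>

text \<open>Exactness of \<open>0 \<rightarrow> Z^n \<rightarrow> Z^r \<rightarrow> Z^d \<rightarrow> 0\<close>. The cokernel of \<open>\<phi>\<close> is the class
  group of the toric variety, so such a \<open>\<beta>\<close> identifies it with \<open>Z^d\<close>.\<close>

definition short_exact :: "int ^ 'n ^ 'r \<Rightarrow> int ^ 'r ^ 'd \<Rightarrow> bool" where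
  "short_exact \<phi> \<beta> \<longleftrightarrow>
     inj (matrix_vector_mult \<phi>) \<and>
     range (matrix_vector_mult \<phi>) = {m. matrix_vector_mult \<beta> m = 0} \<and>
     surj (matrix_vector_mult \<beta>)"

definition relation_lattice :: "int ^ 'r ^ 'd \<Rightarrow> (int ^ 'r) set" where
  "relation_lattice \<beta> = {m. matrix_vector_mult \<beta> m = 0}"

definition sublattice :: "(int ^ 'r) set \<Rightarrow> bool" where
  "sublattice L \<longleftrightarrow> Modules.module.subspace vector_scalar_mult L"

text \<open>\<open>L\<close> is free over the integers with a basis of \<open>k\<close> elements.\<close>

definition has_rank :: "(int ^ 'r) set \<Rightarrow> nat \<Rightarrow> bool" where
  "has_rank L k \<longleftrightarrow>
     (\<exists>S. finite S \<and> card S = k \<and> \<not> Modules.module.dependent vector_scalar_mult S \<and>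
          Modules.module.span vector_scalar_mult S = L)"

section \<open>The Cox ring\<close>

text \<open>Polynomials in the variables \<open>x_i\<close> are finitely supported functions from exponent vectors
  to coefficients.\<close>

type_synonym ('k, 'r) cox_ring = "(nat ^ 'r) \<Rightarrow>\<^sub>0 'k"

definition monomial :: "nat ^ 'r \<Rightarrow> ('k::field, 'r::finite) cox_ring" where
  "monomial a = Poly_Mapping.single a 1"

definition var :: "'r \<Rightarrow> ('k::field, 'r::finite) cox_ring" where
  "var i = monomial (axis i 1)"

definition ideal_gen :: "('k::field, 'r::finite) cox_ring set \<Rightarrow> ('k, 'r) cox_ring set" where
  "ideal_gen = Modules.module.span times"

definition cox_degree :: "int ^ 'r ^ 'd \<Rightarrow> nat ^ 'r \<Rightarrow> int ^ 'd" where
  "cox_degree \<beta> a = (\<Sum>j\<in>UNIV. int (a $ j) *s column j \<beta>)"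

definition homogeneous :: "int ^ 'r ^ 'd \<Rightarrow> ('k::field, 'r::finite) cox_ring \<Rightarrow> bool" where
  "homogeneous \<beta> F \<longleftrightarrow> (\<exists>c. \<forall>a\<in>Poly_Mapping.keys F. cox_degree \<beta> a = c)"

definition pos_part :: "int ^ 'r \<Rightarrow> nat ^ 'r" where
  "pos_part m = (\<chi> i. nat (m $ i))"

definition neg_part :: "int ^ 'r \<Rightarrow> nat ^ 'r" where
  "neg_part m = (\<chi> i. nat (- (m $ i)))"

definition lattice_ideal :: "(int ^ 'r) set \<Rightarrow> ('k::field, 'r::finite) cox_ring set" where
  "lattice_ideal L = ideal_gen {monomial (pos_part m) - monomial (neg_part m) | m. m \<in> L}"

definition irrelevant_ideal ::
  "(real ^ 'n) set set \<Rightarrow> int ^ 'n ^ 'r \<Rightarrow> ('k::field, 'r::finite) cox_ring set" where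
  "irrelevant_ideal \<Sigma> \<phi> = ideal_gen {\<Prod>i | \<not> ray \<phi> i \<subseteq> \<sigma>. var i | \<sigma>. \<sigma> \<in> \<Sigma>}"

section \<open>Points of the toric variety\<close>

type_synonym ('k, 'r) point = "'k alg_closure ^ 'r"

definition evaluate :: "('k::field, 'r::finite) cox_ring \<Rightarrow> ('k, 'r) point \<Rightarrow> 'k alg_closure" where
  "evaluate F P =
     (\<Sum>a\<in>Poly_Mapping.keys F. to_ac (Poly_Mapping.lookup F a) * (\<Prod>i\<in>UNIV. (P $ i) ^ (a $ i)))"

definition zero_locus :: "('k::field, 'r::finite) cox_ring set \<Rightarrow> ('k, 'r) point set" where
  "zero_locus J = {P. \<forall>F\<in>J. evaluate F P = 0}"

definition base_points :: "('k::field, 'r::finite) point set" where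
  "base_points = {P. \<forall>i. P $ i \<in> range to_ac}"

definition torus_points :: "('k::field, 'r::finite) point set" where
  "torus_points = {P. \<forall>i. P $ i \<noteq> 0}"

definition laurent_monomial :: "int ^ 'r \<Rightarrow> ('k::field, 'r::finite) point \<Rightarrow> 'k alg_closure" where
  "laurent_monomial m P = (\<Prod>i\<in>UNIV. (P $ i) powi (m $ i))"

definition G_group :: "int ^ 'r ^ 'd \<Rightarrow> ('k::field, 'r::finite) point set" where
  "G_group \<beta> = {P \<in> torus_points. \<forall>m\<in>relation_lattice \<beta>. laurent_monomial m P = 1}"

text \<open>\<open>*\<close> on \<^typ>\<open>('k, 'r) point\<close> is the coordinatewise product.\<close>

definition orbit :: "int ^ 'r ^ 'd \<Rightarrow> ('k::field, 'r::finite) point \<Rightarrow> ('k, 'r) point set" where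
  "orbit \<beta> P = {g * P | g. g \<in> G_group \<beta>}"

definition torus_group ::
  "int ^ 'r ^ 'd \<Rightarrow> ('k::field, 'r::finite) point set monoid" where
  "torus_group \<beta> =
     \<lparr>carrier = orbit \<beta> ` (base_points \<inter> torus_points),
      monoid.mult = (\<lambda>A B. {P * Q | P Q. P \<in> A \<and> Q \<in> B}),
      one = orbit \<beta> 1\<rparr>"

definition toric_points ::
  "(real ^ 'n) set set \<Rightarrow> int ^ 'n ^ 'r \<Rightarrow> int ^ 'r ^ 'd \<Rightarrow> ('k::field, 'r::finite) point set set" where
  "toric_points \<Sigma> \<phi> \<beta> = orbit \<beta> ` (base_points - zero_locus (irrelevant_ideal \<Sigma> \<phi>))"

text \<open>For homogeneous \<open>F\<close> the condition \<open>F(P) = 0\<close> depends only on the orbit of \<open>P\<close>.\<close>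

definition toric_vanishing ::
  "(real ^ 'n) set set \<Rightarrow> int ^ 'n ^ 'r \<Rightarrow> int ^ 'r ^ 'd \<Rightarrow> ('k::field, 'r::finite) cox_ring set \<Rightarrow>
   ('k, 'r) point set set" where
  "toric_vanishing \<Sigma> \<phi> \<beta> J =
     {A \<in> toric_points \<Sigma> \<phi> \<beta>. \<forall>P\<in>A. \<forall>F\<in>J. homogeneous \<beta> F \<longrightarrow> evaluate F P = 0}"

lemma G_group_one: "1 \<in> G_group \<beta>"
  by (simp add: G_group_def torus_points_def laurent_monomial_def)

lemma G_group_mult: "P \<in> G_group \<beta> \<Longrightarrow> Q \<in> G_group \<beta> \<Longrightarrow> P * Q \<in> G_group \<beta>"
  by (auto simp: G_group_def torus_points_def laurent_monomial_def power_int_mult_distrib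
      prod.distrib)

lemma orbit_mult:
  "{P * Q | P Q. P \<in> orbit \<beta> A \<and> Q \<in> orbit \<beta> B} = orbit \<beta> (A * B)"
proof (intro equalityI subsetI)
  fix x assume "x \<in> {P * Q | P Q. P \<in> orbit \<beta> A \<and> Q \<in> orbit \<beta> B}"
  then obtain g h where gh: "g \<in> G_group \<beta>" "h \<in> G_group \<beta>" "x = (g * A) * (h * B)"
    by (auto simp: orbit_def)
  then have "x = (g * h) * (A * B)" by (simp add: algebra_simps)
  with gh show "x \<in> orbit \<beta> (A * B)"
    unfolding orbit_def using G_group_mult by blast
next
  fix x assume "x \<in> orbit \<beta> (A * B)"
  then obtain g where g: "g \<in> G_group \<beta>" "x = g * (A * B)"
    by (auto simp: orbit_def)
  then have "x = (g * A) * (1 * B)" by (simp add: algebra_simps)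
  with g show "x \<in> {P * Q | P Q. P \<in> orbit \<beta> A \<and> Q \<in> orbit \<beta> B}"
    unfolding orbit_def using G_group_one by blast
qed

lemma torus_group_is_group:
  "group (torus_group \<beta> :: ('k::field, 'r::finite) point set monoid)"
proof (rule groupI)
  let ?T = "torus_group \<beta> :: ('k, 'r) point set monoid"
    and ?U = "base_points \<inter> torus_points :: ('k, 'r) point set"
  have mult: "orbit \<beta> P \<otimes>\<^bsub>?T\<^esub> orbit \<beta> Q = orbit \<beta> (P * Q)" for P Q
    by (simp add: torus_group_def orbit_mult)
  have car: "carrier ?T = orbit \<beta> ` ?U" and one: "\<one>\<^bsub>?T\<^esub> = orbit \<beta> 1"
    by (simp_all add: torus_group_def)
  have U1: "1 \<in> ?U"
    by (auto simp: base_points_def torus_points_def intro!: range_eqI[of _ _ 1])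
  have Um: "P * Q \<in> ?U" if "P \<in> ?U" "Q \<in> ?U" for P Q
    using that
    by (auto simp: base_points_def torus_points_def image_iff) (metis to_ac_mult)
  have Ui: "(\<chi> i. inverse (P $ i)) \<in> ?U" if "P \<in> ?U" for P
    using that
    by (auto simp: base_points_def torus_points_def image_iff) (metis to_ac_inverse)
  have inv: "(\<chi> i. inverse (P $ i)) * P = 1" if "P \<in> ?U" for P
    using that by (auto simp: torus_points_def vec_eq_iff)
  show "x \<otimes>\<^bsub>?T\<^esub> y \<in> carrier ?T" if xy: "x \<in> carrier ?T" "y \<in> carrier ?T" for x y
    proof -
    obtain P Q where "P \<in> ?U" "x = orbit \<beta> P" "Q \<in> ?U" "y = orbit \<beta> Q"
      using xy unfolding car by blast
    then show ?thesis unfolding car using mult Um by blast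
  qed
  show "\<one>\<^bsub>?T\<^esub> \<in> carrier ?T" using U1 by (simp add: car one)
  show "x \<otimes>\<^bsub>?T\<^esub> y \<otimes>\<^bsub>?T\<^esub> z = x \<otimes>\<^bsub>?T\<^esub> (y \<otimes>\<^bsub>?T\<^esub> z)"
    if "x \<in> carrier ?T" "y \<in> carrier ?T" "z \<in> carrier ?T" for x y z
    using that by (auto simp: car mult mult.assoc)
  show "\<one>\<^bsub>?T\<^esub> \<otimes>\<^bsub>?T\<^esub> x = x" if "x \<in> carrier ?T" for x
    using that by (auto simp: car one mult)
  show "\<exists>y\<in>carrier ?T. y \<otimes>\<^bsub>?T\<^esub> x = \<one>\<^bsub>?T\<^esub>" if x: "x \<in> carrier ?T" for x
  proof -
    obtain P where P: "P \<in> ?U" "x = orbit \<beta> P" using x unfolding car by blast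
    have "orbit \<beta> (\<chi> i. inverse (P $ i)) \<otimes>\<^bsub>?T\<^esub> x = \<one>\<^bsub>?T\<^esub>"
      by (simp only: P(2) mult inv[OF P(1)] one)
    moreover have "orbit \<beta> (\<chi> i. inverse (P $ i)) \<in> carrier ?T"
      unfolding car using Ui[OF P(1)] by (rule imageI)
    ultimately show ?thesis by blast
  qed
qed

end

theory Submission
  imports Defs
begin

text \<open>
  Let \<open>P\<close> be a point off the irrelevant locus at which all binomials of \<open>I_L\<close> vanish. The crux is
  that \<open>P\<close> lies in the torus (\<open>lattice_ideal_zero_in_torus\<close>). Being off the irrelevant locus means
  that the rays \<open>\<rho>_i\<close> with \<open>p_i = 0\<close> all lie in one cone \<open>\<sigma>\<close> of the fan
  (\<open>not_in_irrelevant_locus_iff\<close>). As \<open>\<sigma>\<close> contains no line, some integral linear form \<open>u\<close> is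
  positive on the generators of all these rays (\<open>cone_integral_positive_form\<close>). Its image \<open>\<phi> u\<close> is in
  \<open>L_\<beta>\<close>, and since \<open>L\<close> has the full rank \<open>n\<close>, a positive multiple \<open>m\<close> of \<open>\<phi> u\<close> is in \<open>L\<close>
  (\<open>full_rank_sublattice_multiple\<close>). Every vanishing coordinate of \<open>P\<close> now occurs in the monomial
  \<open>x^(m+)\<close> and none occurs in \<open>x^(m-)\<close>. If there is such a coordinate, the binomial of \<open>m\<close> takes
  the value \<open>0 - x^(m-)(P) \<noteq> 0\<close>, a contradiction.

  On the torus, the binomial of \<open>m\<close> vanishes exactly where the character \<open>x^m\<close> equals 1. Hence the
  zero set of \<open>I_L\<close> consists of the orbits of the rational torus points in the common kernel of the
  characters \<open>x^m\<close>, \<open>m \<in> L\<close> (\<open>toric_vanishing_lattice_ideal\<close>). These points form a group, and orbits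
  multiply like their representatives.
\<close>

section \<open>Evaluation of Cox ring elements\<close>

lemma evaluate_superset:
  fixes F :: "('k::field, 'r::finite) cox_ring"
  assumes "finite A" "Poly_Mapping.keys F \<subseteq> A"
  shows "evaluate F P =
    (\<Sum>a\<in>A. to_ac (Poly_Mapping.lookup F a) * (\<Prod>i\<in>UNIV. (P $ i) ^ (a $ i)))"
  unfolding evaluate_def
  by (rule sum.mono_neutral_left) (use assms in \<open>auto simp: in_keys_iff\<close>)

lemma evaluate_zero [simp]: "evaluate (0 :: ('k::field, 'r::finite) cox_ring) P = 0"
  by (simp add: evaluate_def)

lemma evaluate_add:
  fixes F G :: "('k::field, 'r::finite) cox_ring"
  shows "evaluate (F + G) P = evaluate F P + evaluate G P"
proof -
  let ?A = "Poly_Mapping.keys F \<union> Poly_Mapping.keys G"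
  have "Poly_Mapping.keys (F + G) \<subseteq> ?A"
    by (rule Poly_Mapping.keys_add)
  then show ?thesis
    by (simp add: evaluate_superset[of ?A] lookup_add distrib_right sum.distrib)
qed

lemma evaluate_sum:
  "evaluate (\<Sum>x\<in>A. f x :: ('k::field, 'r::finite) cox_ring) P = (\<Sum>x\<in>A. evaluate (f x) P)"
  by (induction A rule: infinite_finite_induct) (simp_all add: evaluate_add)

lemma evaluate_single:
  "evaluate (Poly_Mapping.single a c :: ('k::field, 'r::finite) cox_ring) P =
    to_ac c * (\<Prod>i\<in>UNIV. (P $ i) ^ (a $ i))"
  by (simp add: evaluate_superset[of "{a}"])

lemma poly_mapping_expansion:
  "F = (\<Sum>a\<in>Poly_Mapping.keys F. Poly_Mapping.single a (Poly_Mapping.lookup F a))"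
  by (rule poly_mapping_eqI)
     (auto simp: lookup_sum lookup_single when_def in_keys_iff)

lemma evaluate_mult:
  fixes F G :: "('k::field, 'r::finite) cox_ring"
  shows "evaluate (F * G) P = evaluate F P * evaluate G P"
proof -
  let ?s = "\<lambda>F a. Poly_Mapping.single a (Poly_Mapping.lookup F a) :: ('k, 'r) cox_ring"
  let ?K = Poly_Mapping.keys
  have "F * G = (\<Sum>a\<in>?K F. ?s F a) * (\<Sum>b\<in>?K G. ?s G b)"
    using poly_mapping_expansion[of F] poly_mapping_expansion[of G] by simp
  also have "\<dots> = (\<Sum>a\<in>?K F. \<Sum>b\<in>?K G. ?s F a * ?s G b)"
    by (rule sum_product)
  finally have "evaluate (F * G) P = (\<Sum>a\<in>?K F. \<Sum>b\<in>?K G. evaluate (?s F a * ?s G b) P)"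
    by (simp add: evaluate_sum)
  also have "\<dots> = (\<Sum>a\<in>?K F. \<Sum>b\<in>?K G. evaluate (?s F a) P * evaluate (?s G b) P)"
    by (simp add: mult_single evaluate_single power_add prod.distrib algebra_simps)
  also have "\<dots> = (\<Sum>a\<in>?K F. evaluate (?s F a) P) * (\<Sum>b\<in>?K G. evaluate (?s G b) P)"
    by (rule sum_product[symmetric])
  also have "\<dots> = evaluate F P * evaluate G P"
    using poly_mapping_expansion[of F] poly_mapping_expansion[of G] by (simp flip: evaluate_sum)
  finally show ?thesis .
qed

lemma evaluate_one [simp]: "evaluate (1 :: ('k::field, 'r::finite) cox_ring) P = 1"
  by (simp add: evaluate_single flip: single_one)

lemma evaluate_prod:
  "evaluate (\<Prod>x\<in>A. f x :: ('k::field, 'r::finite) cox_ring) P = (\<Prod>x\<in>A. evaluate (f x) P)"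
  by (induction A rule: infinite_finite_induct) (simp_all add: evaluate_mult)

lemma evaluate_monomial:
  "evaluate (monomial a :: ('k::field, 'r::finite) cox_ring) P = (\<Prod>i\<in>UNIV. (P $ i) ^ (a $ i))"
  by (simp add: monomial_def evaluate_single)

lemma evaluate_var: "evaluate (var i :: ('k::field, 'r::finite) cox_ring) P = P $ i"
proof -
  have "(\<Prod>j\<in>UNIV. (P $ j) ^ (axis i 1 $ j)) = (\<Prod>j\<in>{i}. P $ j)"
    by (rule prod.mono_neutral_cong_right) (auto simp: axis_def)
  then show ?thesis
    by (simp add: var_def evaluate_monomial)
qed

lemma evaluate_diff:
  fixes F G :: "('k::field, 'r::finite) cox_ring"
  shows "evaluate (F - G) P = evaluate F P - evaluate G P"
  using evaluate_add[of "F - G" G P] by simp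

lemma module_cox_ring:
  "Modules.module (times :: ('k::field, 'r::finite) cox_ring \<Rightarrow> ('k, 'r) cox_ring \<Rightarrow> ('k, 'r) cox_ring)"
  by unfold_locales (simp_all add: algebra_simps)

text \<open>The polynomials vanishing at a point form an ideal, so it suffices to look at generators.\<close>

lemma evaluate_ideal_gen_eq_0:
  fixes A :: "('k::field, 'r::finite) cox_ring set"
  assumes "F \<in> ideal_gen A" and "\<And>G. G \<in> A \<Longrightarrow> evaluate G P = 0"
  shows "evaluate F P = 0"
proof -
  interpret Modules.module "times :: ('k, 'r) cox_ring \<Rightarrow> ('k, 'r) cox_ring \<Rightarrow> ('k, 'r) cox_ring"
    by (rule module_cox_ring)
  have "subspace {F :: ('k, 'r) cox_ring. evaluate F P = 0}"
    by (auto simp: subspace_def evaluate_add evaluate_mult)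
  then show ?thesis
    using span_induct[of F A "\<lambda>F. evaluate F P = 0"] assms by (auto simp: ideal_gen_def)
qed

lemma ideal_gen_superset:
  fixes A :: "('k::field, 'r::finite) cox_ring set"
  shows "A \<subseteq> ideal_gen A"
  unfolding ideal_gen_def by (rule Modules.module.span_superset[OF module_cox_ring])

text \<open>The generator of the irrelevant ideal belonging to \<open>\<sigma>\<close> is the product of the variables whose
  rays are outside \<open>\<sigma>\<close>; it is nonzero at \<open>P\<close> iff none of these variables vanishes there.\<close>

lemma not_in_irrelevant_locus_iff:
  fixes P :: "('k::field, 'r::finite) point"
  shows "P \<notin> zero_locus (irrelevant_ideal \<Sigma> \<phi>) \<longleftrightarrow>
    (\<exists>\<sigma>\<in>\<Sigma>. \<forall>i. P $ i = 0 \<longrightarrow> ray \<phi> i \<subseteq> \<sigma>)"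
proof -
  define A :: "('k, 'r) cox_ring set" where
    "A = {\<Prod>i | \<not> ray \<phi> i \<subseteq> \<sigma>. var i | \<sigma>. \<sigma> \<in> \<Sigma>}"
  have "P \<notin> zero_locus (irrelevant_ideal \<Sigma> \<phi>) \<longleftrightarrow> (\<exists>F\<in>A. evaluate F P \<noteq> 0)"
    unfolding zero_locus_def irrelevant_ideal_def A_def[symmetric]
    using evaluate_ideal_gen_eq_0[of _ A P] ideal_gen_superset[of A] by blast
  also have "\<dots> \<longleftrightarrow> (\<exists>\<sigma>\<in>\<Sigma>. \<forall>i. P $ i = 0 \<longrightarrow> ray \<phi> i \<subseteq> \<sigma>)"
  proof -
    have "evaluate (\<Prod>i | \<not> ray \<phi> i \<subseteq> \<sigma>. var i :: ('k, 'r) cox_ring) P \<noteq> 0 \<longleftrightarrow>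
        (\<forall>i. P $ i = 0 \<longrightarrow> ray \<phi> i \<subseteq> \<sigma>)" for \<sigma>
      by (auto simp: evaluate_prod evaluate_var)
    then show ?thesis
      unfolding A_def by blast
  qed
  finally show ?thesis .
qed

section \<open>Lattices of full rank\<close>

lemma module_int_vec: "Modules.module (vector_scalar_mult :: int \<Rightarrow> int ^ 'r \<Rightarrow> int ^ 'r)"
  by unfold_locales (simp_all add: vec_eq_iff algebra_simps)

lemma int_matrix_vector_mult_scale:
  fixes A :: "int ^ 'n::finite ^ 'r"
  shows "A *v (c *s x) = c *s (A *v x)"
  by (simp add: vec_eq_iff matrix_vector_mult_def sum_distrib_left mult_ac)

lemma common_denominator:
  fixes q :: "'a \<Rightarrow> rat"
  assumes "finite S"
  obtains D :: int and z :: "'a \<Rightarrow> int"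
  where "D > 0" "\<And>s. s \<in> S \<Longrightarrow> of_int D * q s = of_int (z s)"
proof -
  define d where "d s = snd (quotient_of (q s))" for s
  define c where "c s = fst (quotient_of (q s))" for s
  have d: "d s > 0" "of_int (d s) * q s = of_int (c s)" for s
  proof -
    show "d s > 0"
      by (simp add: d_def quotient_of_denom_pos')
    moreover have "q s = of_int (c s) / of_int (d s)"
      by (rule quotient_of_div) (simp add: c_def d_def)
    ultimately show "of_int (d s) * q s = of_int (c s)"
      by simp
  qed
  have eq: "of_int (prod d S) * q s = of_int (prod d (S - {s}) * c s)" if "s \<in> S" for s
    using d(2)[of s] by (simp add: prod.remove[OF assms that] mult_ac)
  have "prod d S > 0"
    by (simp add: d prod_pos)
  then show ?thesis
    using eq by (rule that)
qed

text \<open>A basis of \<open>L\<close> lifts along \<open>\<phi>\<close> to \<open>n\<close> integer vectors. By clearing denominators these are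
  linearly independent over the rationals, so they span the rational \<open>n\<close>-space; clearing the
  denominators in an expansion of \<open>u\<close> then gives the multiple.\<close>

lemma full_rank_sublattice_multiple:
  fixes \<phi> :: "int ^ 'n::finite ^ 'r::finite"
  assumes rank: "has_rank L CARD('n)" and sub: "L \<subseteq> range ((*v) \<phi>)"
  obtains k :: int where "k > 0" "k *s (\<phi> *v u) \<in> L"
proof -
  interpret Z: Modules.module "(*s) :: int \<Rightarrow> int ^ 'r \<Rightarrow> int ^ 'r"
    by (rule module_int_vec)
  obtain S where S: "finite S" "card S = CARD('n)" "\<not> Z.dependent S" "Z.span S = L"
    using rank by (auto simp: has_rank_def)
  have "\<forall>s\<in>S. \<exists>x. \<phi> *v x = s"
    using sub Z.span_superset[of S] S(4) by blast
  then obtain w where w: "\<And>s. s \<in> S \<Longrightarrow> \<phi> *v w s = s"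
    by metis
  have lift: "\<phi> *v (\<Sum>s\<in>S. z s *s w s) = (\<Sum>s\<in>S. z s *s s)" for z
  proof -
    have "\<phi> *v (\<Sum>s\<in>S. z s *s w s) = (\<Sum>s\<in>S. \<phi> *v (z s *s w s))"
      using S(1) by (induction S rule: finite_induct) (simp_all add: matrix_vector_right_distrib)
    also have "\<dots> = (\<Sum>s\<in>S. z s *s s)"
      by (rule sum.cong) (simp_all add: w int_matrix_vector_mult_scale)
    finally show ?thesis .
  qed
  define R :: "int ^ 'r \<Rightarrow> rat ^ 'n" where "R s = (\<chi> j. of_int (w s $ j))" for s
  have inj: "inj_on R S"
  proof
    fix s t assume st: "s \<in> S" "t \<in> S" "R s = R t"
    then have "w s = w t" by (simp add: R_def vec_eq_iff)
    with st w show "s = t" by metis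
  qed
  have indep: "vec.independent (R ` S)"
  proof (rule vec.independent_if_scalars_zero)
    show "finite (R ` S)" using S by simp
    fix f x assume 0: "(\<Sum>x\<in>R ` S. f x *s x) = 0" and x: "x \<in> R ` S"
    obtain D z where D: "D > 0" "\<And>s. s \<in> S \<Longrightarrow> of_int D * f (R s) = of_int (z s)"
      using common_denominator[OF S(1), of "\<lambda>s. f (R s)"] by metis
    have "(\<Sum>s\<in>S. f (R s) *s R s) = 0"
      using 0 by (simp add: sum.reindex[OF inj])
    then have R0: "(\<Sum>s\<in>S. f (R s) * of_int (w s $ j)) = 0" for j
      by (simp add: vec_eq_iff R_def)
    have "(\<Sum>s\<in>S. z s *s w s) = 0"
      unfolding vec_eq_iff
    proof
      fix j
      have "of_int D * (\<Sum>s\<in>S. f (R s) * of_int (w s $ j)) = 0"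
        by (simp add: R0)
      then have "rat_of_int (\<Sum>s\<in>S. z s * w s $ j) = 0"
        by (simp add: sum_distrib_left D(2) flip: mult.assoc)
      then have "(\<Sum>s\<in>S. z s * w s $ j) = 0"
        by (simp only: of_int_eq_0_iff)
      then show "(\<Sum>s\<in>S. z s *s w s) $ j = 0 $ j"
        by simp
    qed
    then have "(\<Sum>s\<in>S. z s *s s) = 0"
      using lift[of z] by (simp add: matrix_vector_mult_def vec_eq_iff)
    then have "z s = 0" if "s \<in> S" for s
      using Z.independentD[OF S(3,1)] that by blast
    then have "f (R s) = 0" if "s \<in> S" for s
      using D(1) D(2)[OF that] that by simp
    then show "f x = 0"
      using x by blast
  qed
  have "vec.dim (UNIV :: (rat ^ 'n) set) \<le> card (R ` S)"
    using S(2) by (simp add: card_image[OF inj] card_cart_basis)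
  then have "UNIV \<subseteq> vec.span (R ` S)"
    using vec.card_ge_dim_independent[OF _ indep] by blast
  then have "(\<chi> j. of_int (u $ j)) \<in> vec.span (R ` S)"
    by blast
  then obtain f where f: "(\<chi> j. of_int (u $ j)) = (\<Sum>x\<in>R ` S. f x *s x)"
    using vec.span_finite[of "R ` S"] S(1) by auto
  then have "(\<chi> j. of_int (u $ j)) = (\<Sum>s\<in>S. f (R s) *s R s)"
    by (simp add: sum.reindex[OF inj])
  then have fR: "of_int (u $ j) = (\<Sum>s\<in>S. f (R s) * of_int (w s $ j))" for j
    by (simp add: vec_eq_iff R_def)
  obtain D z where D: "D > 0" "\<And>s. s \<in> S \<Longrightarrow> of_int D * f (R s) = of_int (z s)"
    using common_denominator[OF S(1), of "\<lambda>s. f (R s)"] by metis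
  have "D *s u = (\<Sum>s\<in>S. z s *s w s)"
    unfolding vec_eq_iff
  proof
    fix j
    have "rat_of_int (D * u $ j) = of_int (\<Sum>s\<in>S. z s * w s $ j)"
      by (simp add: fR sum_distrib_left D(2) flip: mult.assoc)
    then have "D * u $ j = (\<Sum>s\<in>S. z s * w s $ j)"
      by (simp only: of_int_eq_iff)
    then show "(D *s u) $ j = (\<Sum>s\<in>S. z s *s w s) $ j"
      by simp
  qed
  then have "D *s (\<phi> *v u) = (\<Sum>s\<in>S. z s *s s)"
    using lift[of z] by (simp flip: int_matrix_vector_mult_scale)
  also have "\<dots> \<in> L"
    unfolding S(4)[symmetric] by (intro Z.span_sum Z.span_scale Z.span_base)
  finally show ?thesis
    using D(1) that by blast
qed

section \<open>Separation by integral linear forms\<close>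

text \<open>A cone without lines stays convex when the origin is removed, because \<open>a x + b y = 0\<close> would
  put \<open>a x\<close> into both the cone and its negative. The convex hull of \<open>V\<close> therefore misses the origin,
  and being compact it can be separated strictly from it.\<close>

lemma strongly_convex_positive_form:
  fixes \<sigma> :: "(real ^ 'n::finite) set"
  assumes cone: "convex_cone \<sigma>" and sc: "strongly_convex \<sigma>"
    and V: "finite V" "V \<subseteq> \<sigma>" "0 \<notin> V"
  obtains u where "\<And>v. v \<in> V \<Longrightarrow> u \<bullet> v > 0"
proof (cases "V = {}")
  case False
  have "convex (\<sigma> - {0})"
    unfolding convex_def
  proof (intro ballI allI impI DiffI)
    fix x y and a b :: real
    assume xy: "x \<in> \<sigma> - {0}" "y \<in> \<sigma> - {0}" and ab: "0 \<le> a" "0 \<le> b" "a + b = 1"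
    have ax: "a *\<^sub>R x \<in> \<sigma>" and by': "b *\<^sub>R y \<in> \<sigma>"
      using cone xy ab by (auto intro: convex_cone_scaleR)
    then show "a *\<^sub>R x + b *\<^sub>R y \<in> \<sigma>"
      using cone by (simp add: convex_cone_add)
    have "a *\<^sub>R x + b *\<^sub>R y \<noteq> 0"
    proof
      assume 0: "a *\<^sub>R x + b *\<^sub>R y = 0"
      then have "a *\<^sub>R x = - (b *\<^sub>R y)"
        by (rule eq_neg_iff_add_eq_0[THEN iffD2])
      with ax by' have "a *\<^sub>R x \<in> \<sigma> \<inter> uminus ` \<sigma>"
        by auto
      with sc have "a *\<^sub>R x = 0"
        by (auto simp: strongly_convex_def)
      with 0 xy ab show False
        by auto
    qed
    then show "a *\<^sub>R x + b *\<^sub>R y \<notin> {0}"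
      by simp
  qed
  then have "convex hull V \<subseteq> \<sigma> - {0}"
    using V by (intro hull_minimal) auto
  then have "0 \<notin> convex hull V"
    by blast
  moreover have "closed (convex hull V)"
    using V(1) by (simp add: finite_imp_compact_convex_hull compact_imp_closed)
  ultimately obtain u b where "0 < b" "\<And>x. x \<in> convex hull V \<Longrightarrow> u \<bullet> x > b"
    using separating_hyperplane_closed_0[of "convex hull V"] by auto
  then show ?thesis
    using that[of u] hull_inc[of _ V convex] by fastforce
qed (use that in auto)

text \<open>Positivity on finitely many vectors survives rounding down a large multiple \<open>N u\<close> of the form:
  the values grow linearly in \<open>N\<close>, while the rounding error at \<open>v\<close> is at most the \<open>\<ell>\<close>-1 norm
  of \<open>v\<close>.\<close>

lemma integral_positive_form:
  fixes u :: "real ^ 'n::finite"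
  assumes V: "finite V" and pos: "\<And>v. v \<in> V \<Longrightarrow> u \<bullet> v > 0"
  obtains a :: "int ^ 'n" where "\<And>v. v \<in> V \<Longrightarrow> real_vec a \<bullet> v > 0"
proof -
  define a :: "nat \<Rightarrow> int ^ 'n" where "a N = (\<chi> j. \<lfloor>real N * u $ j\<rfloor>)" for N
  have "eventually (\<lambda>N. real_vec (a N) \<bullet> v > 0) sequentially" if v: "v \<in> V" for v
  proof -
    define e where "e = (\<Sum>j\<in>UNIV. \<bar>v $ j\<bar>)"
    have bound: "real_vec (a N) \<bullet> v \<ge> real N * (u \<bullet> v) - e" for N
    proof -
      have "real N * (u \<bullet> v) - real_vec (a N) \<bullet> v
          = (\<Sum>j\<in>UNIV. (real N * u $ j - of_int \<lfloor>real N * u $ j\<rfloor>) * v $ j)"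
        by (simp add: inner_vec_def real_vec_def a_def sum_distrib_left algebra_simps
            flip: sum_subtractf)
      also have "\<dots> \<le> (\<Sum>j\<in>UNIV. 1 * \<bar>v $ j\<bar>)"
      proof (rule sum_mono)
        fix j
        define r where "r = real N * u $ j - of_int \<lfloor>real N * u $ j\<rfloor>"
        have "0 \<le> r" "r \<le> 1"
          unfolding r_def by linarith+
        then have "r * v $ j \<le> r * \<bar>v $ j\<bar>" "r * \<bar>v $ j\<bar> \<le> 1 * \<bar>v $ j\<bar>"
          by (intro mult_left_mono mult_right_mono; simp)+
        then show "r * v $ j \<le> 1 * \<bar>v $ j\<bar>"
          by linarith
      qed
      finally show ?thesis
        by (simp add: e_def)
    qed
    obtain M where M: "real M * (u \<bullet> v) > e"
      using reals_Archimedean3[OF pos[OF v]] by blast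
    have "real_vec (a N) \<bullet> v > 0" if "N \<ge> M" for N
    proof -
      have "real M * (u \<bullet> v) \<le> real N * (u \<bullet> v)"
        using that pos[OF v] by (intro mult_right_mono) auto
      with M bound[of N] show ?thesis by linarith
    qed
    then show ?thesis
      by (auto simp: eventually_sequentially)
  qed
  then have "eventually (\<lambda>N. \<forall>v\<in>V. real_vec (a N) \<bullet> v > 0) sequentially"
    using V by (simp add: eventually_ball_finite_distrib)
  then obtain N where "\<forall>v\<in>V. real_vec (a N) \<bullet> v > 0"
    by (auto simp: eventually_sequentially)
  then show ?thesis
    using that by blast
qed

lemma cone_integral_positive_form:
  fixes \<phi> :: "int ^ 'n::finite ^ 'r::finite"
  assumes fan: "fan \<Sigma>" and gens: "ray_generators \<Sigma> \<phi>" and \<sigma>: "\<sigma> \<in> \<Sigma>"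
  obtains u :: "int ^ 'n" where "\<And>i. ray \<phi> i \<subseteq> \<sigma> \<Longrightarrow> (\<phi> *v u) $ i > 0"
proof -
  have "rational_polyhedral_cone \<sigma>" and sc: "strongly_convex \<sigma>"
    using fan \<sigma> by (auto simp: fan_def)
  then have cone: "convex_cone \<sigma>"
    by (auto simp: rational_polyhedral_cone_def convex_cone_convex_cone_hull)
  define V where "V = (\<lambda>i. real_vec (\<phi> $ i)) ` {i. ray \<phi> i \<subseteq> \<sigma>}"
  have "V \<subseteq> \<sigma>"
    using hull_inc[of _ _ convex_cone] by (fastforce simp: V_def ray_def)
  moreover have "0 \<notin> V"
  proof
    assume "0 \<in> V"
    then obtain i where "\<phi> $ i = 0"
      by (auto simp: V_def real_vec_def vec_eq_iff)
    moreover have "primitive (\<phi> $ i)"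
      using gens by (simp add: ray_generators_def)
    ultimately show False
      by (simp add: primitive_def image_def)
  qed
  ultimately obtain u where u: "\<And>v. v \<in> V \<Longrightarrow> u \<bullet> v > 0"
    using strongly_convex_positive_form[OF cone sc, of V] finite_imageI[OF finite]
    unfolding V_def by metis
  obtain a :: "int ^ 'n" where a: "\<And>v. v \<in> V \<Longrightarrow> real_vec a \<bullet> v > 0"
    using integral_positive_form[of V u] u finite_imageI[OF finite]
    unfolding V_def by metis
  have "(\<phi> *v a) $ i > 0" if "ray \<phi> i \<subseteq> \<sigma>" for i
  proof -
    have "real_of_int ((\<phi> *v a) $ i) = real_vec a \<bullet> real_vec (\<phi> $ i)"
      by (simp add: matrix_vector_mult_def inner_vec_def real_vec_def mult.commute)
    also have "\<dots> > 0"
      using a that by (auto simp: V_def)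
    finally show ?thesis by simp
  qed
  then show ?thesis
    using that by blast
qed

section \<open>Zeros of a lattice ideal\<close>

text \<open>Vanishing on the toric variety tests only homogeneous polynomials. This makes the binomials of
  the lattice available for that test: the degrees of their two terms differ by \<open>\<beta> m = 0\<close>.\<close>

lemma lattice_binomial_homogeneous:
  fixes \<beta> :: "int ^ 'r::finite ^ 'd::finite"
  assumes "m \<in> relation_lattice \<beta>"
  shows "homogeneous \<beta> (monomial (pos_part m) - monomial (neg_part m) :: ('k::field, 'r) cox_ring)"
proof -
  have "cox_degree \<beta> (pos_part m) - cox_degree \<beta> (neg_part m) = \<beta> *v m"
    unfolding cox_degree_def vec_eq_iff
    by (auto simp: matrix_vector_mult_def pos_part_def neg_part_def column_def
        simp flip: sum_subtractf left_diff_distrib intro!: sum.cong)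
  also have "\<dots> = 0"
    using assms by (simp add: relation_lattice_def)
  finally have "cox_degree \<beta> (pos_part m) = cox_degree \<beta> (neg_part m)"
    by simp
  moreover have "Poly_Mapping.keys (monomial (pos_part m) - monomial (neg_part m) :: ('k, 'r) cox_ring)
      \<subseteq> {pos_part m, neg_part m}"
    by (auto simp: monomial_def in_keys_iff lookup_minus lookup_single when_def split: if_splits)
  ultimately show ?thesis
    unfolding homogeneous_def by (metis insertE singletonD subsetD)
qed

lemma laurent_monomial_eq_1_iff:
  fixes P :: "('k::field, 'r::finite) point"
  assumes P: "P \<in> torus_points"
  shows "laurent_monomial m P = 1 \<longleftrightarrow>
    evaluate (monomial (pos_part m) :: ('k, 'r) cox_ring) P = evaluate (monomial (neg_part m)) P"
proof -
  have "(P $ i) powi (m $ i) = (P $ i) ^ (pos_part m $ i) / (P $ i) ^ (neg_part m $ i)" for i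
    by (auto simp: pos_part_def neg_part_def power_int_def field_simps)
  then have "laurent_monomial m P =
      evaluate (monomial (pos_part m) :: ('k, 'r) cox_ring) P / evaluate (monomial (neg_part m)) P"
    by (simp add: laurent_monomial_def evaluate_monomial prod_dividef)
  moreover have "evaluate (monomial (neg_part m) :: ('k, 'r) cox_ring) P \<noteq> 0"
    using P by (simp add: evaluate_monomial torus_points_def)
  ultimately show ?thesis
    by simp
qed

lemma lattice_ideal_zero_in_torus:
  fixes \<phi> :: "int ^ 'n::finite ^ 'r::finite" and P :: "('k::field, 'r) point"
  assumes fan: "fan \<Sigma>" and gens: "ray_generators \<Sigma> \<phi>"
    and rank: "has_rank L CARD('n)" and sub: "L \<subseteq> range ((*v) \<phi>)"
    and P: "P \<notin> zero_locus (irrelevant_ideal \<Sigma> \<phi>)"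
    and zero: "\<And>m. m \<in> L \<Longrightarrow> evaluate (monomial (pos_part m) :: ('k, 'r) cox_ring) P
                 = evaluate (monomial (neg_part m)) P"
  shows "P \<in> torus_points"
proof (rule ccontr)
  assume "P \<notin> torus_points"
  then obtain i where i: "P $ i = 0"
    by (auto simp: torus_points_def)
  obtain \<sigma> where \<sigma>: "\<sigma> \<in> \<Sigma>" "\<And>j. P $ j = 0 \<Longrightarrow> ray \<phi> j \<subseteq> \<sigma>"
    using P by (auto simp: not_in_irrelevant_locus_iff)
  obtain u where u: "\<And>j. ray \<phi> j \<subseteq> \<sigma> \<Longrightarrow> (\<phi> *v u) $ j > 0"
    using cone_integral_positive_form[OF fan gens \<sigma>(1)] by blast
  obtain k where k: "k > 0" "k *s (\<phi> *v u) \<in> L"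
    using full_rank_sublattice_multiple[OF rank sub] by blast
  \<comment> \<open>Since \<open>m\<close> is positive on the vanishing coordinates, its binomial has exactly one term that
    vanishes at \<open>P\<close>.\<close>
  define m where "m = k *s (\<phi> *v u)"
  have m: "m $ j > 0" if "P $ j = 0" for j
    using u[OF \<sigma>(2)[OF that]] k by (simp add: m_def)
  have "evaluate (monomial (pos_part m) :: ('k, 'r) cox_ring) P = 0"
    using i m[OF i] by (auto simp: evaluate_monomial pos_part_def)
  moreover have "evaluate (monomial (neg_part m) :: ('k, 'r) cox_ring) P \<noteq> 0"
    using m by (fastforce simp: evaluate_monomial neg_part_def)
  ultimately show False
    using zero k(2) by (simp add: m_def)
qed

lemma laurent_monomial_one [simp]: "laurent_monomial m (1 :: ('k::field, 'r::finite) point) = 1"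
  by (simp add: laurent_monomial_def)

lemma laurent_monomial_mult:
  "laurent_monomial m (P * Q) = laurent_monomial m P * laurent_monomial m Q"
  by (simp add: laurent_monomial_def power_int_mult_distrib prod.distrib)

lemma torus_points_mult:
  "P \<in> torus_points \<Longrightarrow> Q \<in> torus_points \<Longrightarrow> P * Q \<in> torus_points"
  by (simp add: torus_points_def)

definition lattice_kernel :: "(int ^ 'r) set \<Rightarrow> ('k::field, 'r::finite) point set" where
  "lattice_kernel L =
     {P \<in> base_points \<inter> torus_points. \<forall>m\<in>L. laurent_monomial m P = 1}"

text \<open>Vanishing at a torus point of all binomials of \<open>L\<close> is the condition defining the kernel. It
  passes from a representative to its whole orbit because \<open>G\<close> is killed by all characters in the
  relation lattice, which contains \<open>L\<close>.\<close>

lemma toric_vanishing_lattice_ideal: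
  fixes \<phi> :: "int ^ 'n::finite ^ 'r::finite" and \<beta> :: "int ^ 'r ^ 'd::finite"
  assumes fan: "fan \<Sigma>" "\<Sigma> \<noteq> {}" and gens: "ray_generators \<Sigma> \<phi>"
    and rank: "has_rank L CARD('n)" and L: "L \<subseteq> relation_lattice \<beta>"
    and exact: "relation_lattice \<beta> \<subseteq> range ((*v) \<phi>)"
  shows "toric_vanishing \<Sigma> \<phi> \<beta> (lattice_ideal L :: ('k::field, 'r) cox_ring set) =
    orbit \<beta> ` lattice_kernel L"
proof (intro equalityI subsetI)
  fix A assume A: "A \<in> toric_vanishing \<Sigma> \<phi> \<beta> (lattice_ideal L :: ('k, 'r) cox_ring set)"
  then obtain P where P: "A = orbit \<beta> P" "P \<in> base_points"
      "P \<notin> zero_locus (irrelevant_ideal \<Sigma> \<phi>)"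
    by (auto simp: toric_vanishing_def toric_points_def)
  have "1 * P \<in> A"
    unfolding P(1) orbit_def using G_group_one by blast
  then have "P \<in> A" by simp
  have zero: "evaluate (monomial (pos_part m) :: ('k, 'r) cox_ring) P
      = evaluate (monomial (neg_part m)) P" if m: "m \<in> L" for m
  proof -
    let ?F = "monomial (pos_part m) - monomial (neg_part m) :: ('k, 'r) cox_ring"
    have "?F \<in> lattice_ideal L"
      unfolding lattice_ideal_def using m by (intro subsetD[OF ideal_gen_superset]) blast
    moreover have "homogeneous \<beta> ?F"
      using m L by (intro lattice_binomial_homogeneous) auto
    ultimately have "evaluate ?F P = 0"
      using A \<open>P \<in> A\<close> by (auto simp: toric_vanishing_def)
    then show ?thesis by (simp add: evaluate_diff)
  qed
  have "P \<in> torus_points"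
    by (rule lattice_ideal_zero_in_torus[OF fan(1) gens rank _ P(3) zero]) (use L exact in auto)
  then have "P \<in> lattice_kernel L"
    using P(2) zero by (simp add: lattice_kernel_def laurent_monomial_eq_1_iff)
  then show "A \<in> orbit \<beta> ` lattice_kernel L"
    using P(1) by blast
next
  fix A :: "('k, 'r) point set" assume "A \<in> orbit \<beta> ` lattice_kernel L"
  then obtain P where A: "A = orbit \<beta> P" and P: "P \<in> lattice_kernel L"
    by blast
  have "P \<notin> zero_locus (irrelevant_ideal \<Sigma> \<phi>)"
    using P fan(2) by (auto simp: not_in_irrelevant_locus_iff lattice_kernel_def torus_points_def)
  then have "A \<in> toric_points \<Sigma> \<phi> \<beta>"
    using P by (auto simp: toric_points_def A lattice_kernel_def)
  moreover have "evaluate F Q = 0"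
    if Q: "Q \<in> A" and F: "F \<in> lattice_ideal L" for Q and F :: "('k, 'r) cox_ring"
  proof -
    obtain g where g: "g \<in> G_group \<beta>" "Q = g * P"
      using Q by (auto simp: A orbit_def)
    have torus: "Q \<in> torus_points"
      using g P by (simp add: G_group_def lattice_kernel_def torus_points_mult)
    have "laurent_monomial m Q = 1" if "m \<in> L" for m
      using g P L that by (auto simp: G_group_def lattice_kernel_def laurent_monomial_mult)
    then show ?thesis
      using F unfolding lattice_ideal_def
      by (elim evaluate_ideal_gen_eq_0)
        (auto simp: evaluate_diff laurent_monomial_eq_1_iff[OF torus])
  qed
  ultimately show "A \<in> toric_vanishing \<Sigma> \<phi> \<beta> (lattice_ideal L)"
    by (simp add: toric_vanishing_def)
qed

section \<open>The group structure\<close>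

lemma lattice_kernel_one: "1 \<in> lattice_kernel L"
  by (auto simp: lattice_kernel_def base_points_def torus_points_def intro!: range_eqI[of _ _ 1])

lemma lattice_kernel_mult:
  "P \<in> lattice_kernel L \<Longrightarrow> Q \<in> lattice_kernel L \<Longrightarrow> P * Q \<in> lattice_kernel L"
  by (auto simp: lattice_kernel_def base_points_def torus_points_mult laurent_monomial_mult image_iff)
     (metis to_ac_mult)

lemma lattice_kernel_inverse:
  fixes P :: "('k::field, 'r::finite) point"
  assumes "P \<in> lattice_kernel L"
  obtains Q where "Q \<in> lattice_kernel L" "Q * P = 1"
proof
  let ?Q = "(\<chi> i. inverse (P $ i)) :: ('k, 'r) point"
  show inv: "?Q * P = 1"
    using assms by (simp add: lattice_kernel_def torus_points_def vec_eq_iff)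
  have "laurent_monomial m ?Q = 1" if "m \<in> L" for m
    using laurent_monomial_mult[of m ?Q P] assms that inv by (simp add: lattice_kernel_def)
  then show "?Q \<in> lattice_kernel L"
    using assms
    by (auto simp: lattice_kernel_def base_points_def torus_points_def image_iff)
       (metis to_ac_inverse)
qed

lemma subgroup_orbit_lattice_kernel:
  fixes \<beta> :: "int ^ 'r::finite ^ 'd::finite"
  shows "subgroup (orbit \<beta> ` (lattice_kernel L :: ('k::field, 'r) point set)) (torus_group \<beta>)"
    (is "subgroup ?H ?T")
proof -
  interpret group ?T by (rule torus_group_is_group)
  have mult: "orbit \<beta> P \<otimes>\<^bsub>?T\<^esub> orbit \<beta> Q = orbit \<beta> (P * Q)" for P Q :: "('k, 'r) point"
    by (simp add: torus_group_def orbit_mult)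
  have one: "\<one>\<^bsub>?T\<^esub> = orbit \<beta> 1"
    by (simp add: torus_group_def)
  show ?thesis
  proof (rule subgroupI)
    show sub: "?H \<subseteq> carrier ?T"
      by (auto simp: torus_group_def lattice_kernel_def)
    show "?H \<noteq> {}"
      using lattice_kernel_one by blast
    show "inv\<^bsub>?T\<^esub> A \<in> ?H" if A: "A \<in> ?H" for A
    proof -
      obtain P where P: "A = orbit \<beta> P" "P \<in> lattice_kernel L"
        using A by blast
      obtain Q where Q: "Q \<in> lattice_kernel L" "Q * P = 1"
        using lattice_kernel_inverse[OF P(2)] by blast
      have "orbit \<beta> Q \<otimes>\<^bsub>?T\<^esub> A = \<one>\<^bsub>?T\<^esub>"
        by (simp add: P(1) mult Q(2) one)
      then have "inv\<^bsub>?T\<^esub> A = orbit \<beta> Q"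
        using sub A Q(1) by (intro inv_equality) auto
      with Q(1) show ?thesis by simp
    qed
    show "A \<otimes>\<^bsub>?T\<^esub> B \<in> ?H" if "A \<in> ?H" "B \<in> ?H" for A B
      using that by (auto simp: mult lattice_kernel_mult)
  qed
qed

theorem proposition3p3:
  fixes \<Sigma> :: "(real ^ 'n::finite) set set"
    and \<phi> :: "int ^ 'n ^ 'r::finite"
    and \<beta> :: "int ^ 'r ^ 'd::finite"
    and L :: "(int ^ 'r) set"
  assumes "complete_fan \<Sigma>"
    and "simplicial_fan \<Sigma>"
    and "ray_generators \<Sigma> \<phi>"
    and "CARD('d) = CARD('r) - CARD('n)"
    and "short_exact \<phi> \<beta>"
    and "sublattice L"
    and "L \<subseteq> relation_lattice \<beta>"
    and "has_rank L CARD('n)"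
  shows "subgroup
           (toric_vanishing \<Sigma> \<phi> \<beta> (lattice_ideal L :: ('k::field, 'r) cox_ring set))
           (torus_group \<beta>)"
proof -
  have "fan \<Sigma>" "\<Sigma> \<noteq> {}"
    using assms(1) by (auto simp: complete_fan_def)
  moreover have "relation_lattice \<beta> \<subseteq> range ((*v) \<phi>)"
    using assms(5) by (simp add: short_exact_def relation_lattice_def)
  ultimately show ?thesis
    using toric_vanishing_lattice_ideal[where 'k = 'k, of \<Sigma> \<phi> L \<beta>] assms(3,7,8)
      subgroup_orbit_lattice_kernel[where 'k = 'k, of \<beta> L]
    by simp
qed

end
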